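(* Let $a>1$, $h(x)=1+ax(1-x)$, and $\lambda=\nu C$ for some $0<\nu<1$. There exists $\eta\in(0,1)$ such that, if the initial states of the dynamical systems $(x_k^C(t),0\le k\le C)$, $C\ge1$, satisfy $$\lim_{C\to+\infty}\sum_{k\ge\eta C}x_k^C(0)=0,$$ then there exists $\eta^*\in(0,1)$ such that $$\lim_{C\to+\infty}\ \sup_{t\ge0}\left(\sum_{k\ge\eta^*C}x_k^C(t)\right)=0.$$
   Context: For each integer $C\ge1$, $(x_k^C(t),0\le k\le C)$ is a probability distribution on $\{0,\dots,C\}$ for each $t\ge0$, solution of the system of ODEs (the Dynamic Alternative Routing system), for $1\le j<C$, $$\frac{\mathrm{d}x_0^C}{\mathrm{d}t}(t)=x_1^C(t)-\lambda h(x_C^C(t))\,x_0^C(t),$$ $$\frac{\mathrm{d}x_j^C}{\mathrm{d}t}(t)=\lambda h(x_C^C(t))\,x_{j-1}^C(t)+(j+1)x_{j+1}^C(t)-\bigl(\lambda h(x_C^C(t))+j\bigr)x_j^C(t),$$ $$\frac{\mathrm{d}x_C^C}{\mathrm{d}t}(t)=\lambda h(x_C^C(t))\,x_{C-1}^C(t)-C\,x_C^C(t),$$ where here $\lambda=\nu C$. *)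

theory Defs
  imports "HOL-Analysis.Analysis"
begin

text \<open>
  The Dynamic Alternative Routing system with capacity \<open>C\<close>, arrival rate \<open>lam\<close> and overflow
  function \<open>h\<close>; \<open>x k t\<close> stands for $x_k^C(t)$. At time \<open>0\<close> the derivative is one-sided, and
  the values \<open>x k t\<close> for \<open>k > C\<close> or \<open>t < 0\<close> are irrelevant.
\<close>

definition DAR_solution ::
    "(real \<Rightarrow> real) \<Rightarrow> real \<Rightarrow> nat \<Rightarrow> (nat \<Rightarrow> real \<Rightarrow> real) \<Rightarrow> bool" where
  "DAR_solution h lam C x \<longleftrightarrow>
    (\<forall>t\<ge>0. (\<forall>k\<le>C. 0 \<le> x k t) \<and> (\<Sum>k\<le>C. x k t) = 1) \<and>
    (\<forall>t\<ge>0.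
      (x 0 has_real_derivative
         x 1 t - lam * h (x C t) * x 0 t) (at t within {0..}) \<and>
      (\<forall>j. 1 \<le> j \<and> j < C \<longrightarrow>
        (x j has_real_derivative
           lam * h (x C t) * x (j - 1) t + real (j + 1) * x (j + 1) t
             - (lam * h (x C t) + real j) * x j t) (at t within {0..})) \<and>
      (x C has_real_derivative
         lam * h (x C t) * x (C - 1) t - real C * x C t) (at t within {0..}))"

text \<open>The mass that a distribution \<open>p\<close> on \<open>{0..C}\<close> gives to the levels \<open>k \<ge> r\<close>.\<close>

definition tail_mass :: "nat \<Rightarrow> real \<Rightarrow> (nat \<Rightarrow> real) \<Rightarrow> real" where
  "tail_mass C r p = (\<Sum>k | k \<le> C \<and> r \<le> real k. p k)"

end

theory Submission
  imports Defs
begin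

text \<open>
  Fix \<open>\<nu> < m < 1\<close> and test the system against the quadratic excess \<open>V k = (max 0 (k / C - m))\<^sup>2\<close>.
  As long as the birth rate \<open>L = \<lambda> h(x\<^sub>C)\<close> is at most \<open>m C\<close>, the drift above level \<open>m C\<close> points
  downwards and \<open>G = \<Sum>k. V k x\<^sub>k\<close> satisfies \<open>G' \<le> - 2 G + 2 / C\<close>. Conversely \<open>(1 - m)\<^sup>2 x\<^sub>C \<le> G\<close>,
  so the rate stays below \<open>m C\<close> while \<open>G\<close> is small. Hence \<open>G\<close> cannot cross any small level above
  \<open>1 / C\<close>, and with \<open>\<eta> = m\<close> it stays below \<open>\<epsilon>\<^sub>C + 2 / C\<close> forever, where \<open>\<epsilon>\<^sub>C \<longrightarrow> 0\<close> is the initial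
  tail mass. Chebyshev's inequality bounds the mass above \<open>\<eta>* C\<close> for any \<open>\<eta>* > m\<close>.
\<close>

text \<open>At a first hitting time of \<open>M\<close> the negative derivative would put
  \<open>G\<close> strictly above \<open>M\<close> just before, and the intermediate value theorem
  would then give an earlier hit. The sign of \<open>D\<close> is required only on the level
  \<open>M\<close> itself; this is what allows the bootstrap, where the drift is controlled only
  while \<open>G\<close> is small.\<close>

lemma below_barrier:
  fixes G D :: "real \<Rightarrow> real"
  assumes deriv: "\<And>t. t \<ge> 0 \<Longrightarrow> (G has_real_derivative D t) (at t within {0..})"
    and start: "G 0 < M"
    and neg: "\<And>t. t \<ge> 0 \<Longrightarrow> G t = M \<Longrightarrow> D t < 0"
    and "s \<ge> 0"
  shows "G s < M"
proof (rule ccontr)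
  assume "\<not> G s < M"
  have cont: "continuous_on {0..} G"
    by (rule DERIV_continuous_on) (use deriv in auto)
  have hit: "\<exists>t. 0 \<le> t \<and> t \<le> u \<and> G t = M" if "0 \<le> u" "M \<le> G u" for u
    using IVT'[of G 0 M u] start that continuous_on_subset[OF cont, of "{0..u}"] by auto
  define S where "S = {t \<in> {0..s}. G t = M}"
  have "S = {0..s} \<inter> G -` {M}"
    by (auto simp: S_def)
  moreover have "closed ({0..s} \<inter> G -` {M})"
    by (rule continuous_closed_preimage) (auto intro: continuous_on_subset[OF cont])
  ultimately have "closed S"
    by simp
  moreover have "S \<noteq> {}"
    using hit[of s] \<open>\<not> G s < M\<close> \<open>s \<ge> 0\<close> by (auto simp: S_def)
  moreover have bdd: "bdd_below S"
    by (rule bdd_belowI[of _ 0]) (auto simp: S_def)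
  ultimately have "Inf S \<in> S"
    using closed_contains_Inf by blast
  then have t0: "0 \<le> Inf S" "Inf S \<le> s" "G (Inf S) = M"
    by (auto simp: S_def)
  then have pos: "0 < Inf S"
    using start by (cases "Inf S = 0") auto
  obtain d where d: "d > 0"
      "\<And>e. 0 < e \<Longrightarrow> Inf S - e \<in> {0..} \<Longrightarrow> e < d \<Longrightarrow> G (Inf S) < G (Inf S - e)"
    using has_real_derivative_neg_dec_left[OF deriv[OF t0(1)] neg[OF t0(1,3)]] by blast
  \<comment> \<open>Halving gives \<open>e < d\<close>, and the minimum keeps
    \<open>Inf S - e\<close> in the half-line on which \<open>G\<close> is differentiable.\<close>
  define e where "e = min (Inf S) d / 2"
  have e: "0 < e" "e \<le> Inf S" "e < d"
    using pos d(1) by (auto simp: e_def)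
  then have "M \<le> G (Inf S - e)"
    using d(2)[of e] t0 by simp
  then obtain t where "0 \<le> t" "t \<le> Inf S - e" "G t = M"
    using hit[of "Inf S - e"] e by auto
  then have "t \<in> S" "t < Inf S"
    using e t0 by (auto simp: S_def)
  then show False
    using cInf_lower[OF _ bdd] by force
qed

section \<open>Moments of the system in flux form\<close>

lemma sum_by_parts_flux:
  fixes V F :: "nat \<Rightarrow> real"
  shows "(\<Sum>j\<le>C. V j * ((if j = 0 then 0 else F (j - 1)) - (if j = C then 0 else F j)))
    = (\<Sum>j<C. F j * (V (Suc j) - V j))"
proof -
  have "(\<Sum>j\<le>C. V j * (if j = 0 then 0 else F (j - 1))) = (\<Sum>j<C. V (Suc j) * F j)"
    by (subst sum.atMost_shift) simp
  moreover have "(\<Sum>j\<le>C. V j * (if j = C then 0 else F j)) = (\<Sum>j<C. V j * F j)"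
    by (simp add: lessThan_Suc_atMost[symmetric])
  ultimately show ?thesis
    by (simp add: algebra_simps sum_subtractf sum.distrib)
qed

lemma DAR_solution_nonneg:
  "DAR_solution h lam C x \<Longrightarrow> t \<ge> 0 \<Longrightarrow> k \<le> C \<Longrightarrow> 0 \<le> x k t"
  by (simp add: DAR_solution_def)

lemma DAR_solution_sum:
  "DAR_solution h lam C x \<Longrightarrow> t \<ge> 0 \<Longrightarrow> (\<Sum>k\<le>C. x k t) = 1"
  by (simp add: DAR_solution_def)

lemma DAR_solution_le_1:
  assumes "DAR_solution h lam C x" "t \<ge> 0" "k \<le> C"
  shows "x k t \<le> 1"
  using member_le_sum[of k "{..C}" "\<lambda>k. x k t"] DAR_solution_nonneg[OF assms(1,2)]
    DAR_solution_sum[OF assms(1,2)] assms(3) by auto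

text \<open>With \<open>F j\<close> the net flux from level \<open>j\<close> to level
  \<open>j + 1\<close>, each equation of the system reads \<open>F (j - 1) - F j\<close>, without
  the flux that would leave {0..C}. Summation by parts moves the difference onto \<open>V\<close>
  with no boundary terms.\<close>

lemma DAR_solution_moment_derivative:
  assumes sol: "DAR_solution h lam C x" and "C \<ge> 1" "t \<ge> 0"
  shows "((\<lambda>t. \<Sum>k\<le>C. V k * x k t) has_real_derivative
      (\<Sum>j<C. (lam * h (x C t) * x j t - real (Suc j) * x (Suc j) t) * (V (Suc j) - V j)))
    (at t within {0..})"
proof -
  define F where "F j = lam * h (x C t) * x j t - real (Suc j) * x (Suc j) t" for j
  have "(x j has_real_derivative
      (if j = 0 then 0 else F (j - 1)) - (if j = C then 0 else F j)) (at t within {0..})"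
    if "j \<le> C" for j
  proof -
    consider "j = 0" | "1 \<le> j" "j < C" | "j = C"
      using \<open>j \<le> C\<close> by linarith
    then show ?thesis
    proof cases
      case 1
      then show ?thesis
        using sol \<open>C \<ge> 1\<close> \<open>t \<ge> 0\<close> by (auto simp: DAR_solution_def F_def)
    next
      case 2
      then have "(x j has_real_derivative
          lam * h (x C t) * x (j - 1) t + real (j + 1) * x (j + 1) t
          - (lam * h (x C t) + real j) * x j t) (at t within {0..})"
        using sol \<open>t \<ge> 0\<close> by (auto simp: DAR_solution_def)
      then show ?thesis
        using 2 by (simp add: F_def algebra_simps)
    next
      case 3
      then show ?thesis
        using sol \<open>C \<ge> 1\<close> \<open>t \<ge> 0\<close> by (auto simp: DAR_solution_def F_def)
    qed
  qed
  then have "((\<lambda>t. \<Sum>k\<le>C. V k * x k t) has_real_derivative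
      (\<Sum>j\<le>C. V j * ((if j = 0 then 0 else F (j - 1)) - (if j = C then 0 else F j))))
    (at t within {0..})"
    by (intro DERIV_sum DERIV_cmult) auto
  then show ?thesis
    unfolding sum_by_parts_flux by (simp only: F_def)
qed

section \<open>Drift of the quadratic excess\<close>

definition sq_excess :: "real \<Rightarrow> nat \<Rightarrow> nat \<Rightarrow> real" where
  "sq_excess m C k = (max 0 (real k / real C - m))\<^sup>2"

text \<open>Second-order Taylor bound: the squared positive part has derivative
  \<open>2 * max 0 y\<close>, which is Lipschitz with constant 2. It serves steps \<open>d\<close>
  of both signs.\<close>

lemma pos_part_square_step:
  fixes y d :: real
  shows "(max 0 (y + d))\<^sup>2 \<le> (max 0 y)\<^sup>2 + 2 * max 0 y * d + d\<^sup>2"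
proof (cases "0 \<le> y")
  case True
  have "(max 0 (y + d))\<^sup>2 \<le> (y + d)\<^sup>2"
    by (auto simp: max_def)
  with True show ?thesis
    by (simp add: power2_sum algebra_simps)
next
  case False
  have "(max 0 (y + d))\<^sup>2 \<le> d\<^sup>2"
    by (rule abs_le_square_iff[THEN iffD1]) (use False in \<open>auto simp: max_def\<close>)
  with False show ?thesis
    by (simp add: max_def)
qed

text \<open>The first-order part of the drift pulls down: where the excess \<open>y j\<close> is
  positive, \<open>(L - j) / C\<close> is at most \<open>- y j\<close>, which yields the term in -2.
  The second-order errors add up to at most \<open>(L + j) / C^2\<close>, hence to the remainder
  \<open>2 / C\<close>.\<close>

lemma sq_excess_drift:
  fixes p :: "nat \<Rightarrow> real"
  assumes C: "C \<ge> 1" and m: "0 \<le> m" "m \<le> 1" and L: "0 \<le> L" "L \<le> m * real C"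
    and p: "\<And>k. k \<le> C \<Longrightarrow> 0 \<le> p k" "(\<Sum>k\<le>C. p k) = 1"
  shows "(\<Sum>j<C. (L * p j - real (Suc j) * p (Suc j)) * (sq_excess m C (Suc j) - sq_excess m C j))
    \<le> - 2 * (\<Sum>k\<le>C. sq_excess m C k * p k) + 2 / real C"
proof -
  define c where "c = real C"
  have c: "c \<ge> 1"
    using C by (simp add: c_def)
  define y where "y k = max 0 (real k / c - m)" for k
  let ?V = "sq_excess m C"
  have V: "?V k = (y k)\<^sup>2" for k
    by (simp add: sq_excess_def y_def c_def)
  have y0: "0 \<le> y k" for k
    by (simp add: y_def)
  have up: "?V (Suc k) - ?V k \<le> 2 * y k / c + 1 / c\<^sup>2" for k
    using pos_part_square_step[of "real k / c - m" "1 / c"]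
    by (simp add: V y_def field_simps add_divide_distrib diff_divide_distrib)
  \<comment> \<open>Expanding around the upper level gives the gradient at \<open>y (Suc k)\<close>,
    the level that a death leaves, to match the weight \<open>p (Suc k)\<close>.\<close>
  have down: "2 * y (Suc k) / c - 1 / c\<^sup>2 \<le> ?V (Suc k) - ?V k" for k
    using pos_part_square_step[of "real (Suc k) / c - m" "- 1 / c"]
    by (simp add: V y_def field_simps add_divide_distrib diff_divide_distrib)
  have "(\<Sum>j<C. L * p j * (?V (Suc j) - ?V j)) \<le> (\<Sum>j<C. L * p j * (2 * y j / c + 1 / c\<^sup>2))"
    using L p by (intro sum_mono mult_left_mono up) auto
  \<comment> \<open>The extra term at \<open>j = C\<close> is nonnegative; including it lets births
    and deaths be compared level by level.\<close>
  also have "\<dots> \<le> (\<Sum>j\<le>C. L * p j * (2 * y j / c + 1 / c\<^sup>2))"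
    using L p y0 c by (intro sum_mono2) auto
  finally have birth: "(\<Sum>j<C. L * p j * (?V (Suc j) - ?V j))
      \<le> (\<Sum>j\<le>C. L * p j * (2 * y j / c + 1 / c\<^sup>2))" .
  \<comment> \<open>The factor \<open>real j\<close> kills the term at 0, so the index shift is
    exact.\<close>
  have "(\<Sum>j\<le>C. real j * p j * (2 * y j / c - 1 / c\<^sup>2))
      = (\<Sum>j<C. real (Suc j) * p (Suc j) * (2 * y (Suc j) / c - 1 / c\<^sup>2))"
    by (subst sum.atMost_shift) simp
  also have "\<dots> \<le> (\<Sum>j<C. real (Suc j) * p (Suc j) * (?V (Suc j) - ?V j))"
    using p by (intro sum_mono mult_left_mono down) auto
  finally have death: "(\<Sum>j\<le>C. real j * p j * (2 * y j / c - 1 / c\<^sup>2))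
      \<le> (\<Sum>j<C. real (Suc j) * p (Suc j) * (?V (Suc j) - ?V j))" .
  have pointwise: "L * p j * (2 * y j / c + 1 / c\<^sup>2) - real j * p j * (2 * y j / c - 1 / c\<^sup>2)
      \<le> - 2 * (?V j * p j) + 2 / c * p j" if "j \<le> C" for j
  proof -
    have "(L - real j) / c \<le> m - real j / c"
      using L c by (simp add: c_def field_simps)
    then have "y j * ((L - real j) / c) \<le> y j * (m - real j / c)"
      by (intro mult_left_mono y0)
    also have "\<dots> = - (y j)\<^sup>2"
      by (cases "real j / c - m \<le> 0") (simp_all add: y_def power2_eq_square right_diff_distrib left_diff_distrib)
    finally have 1: "y j * ((L - real j) / c) \<le> - (y j)\<^sup>2" .
    have "m * c \<le> c"
      using m c by (simp add: mult_left_le_one_le)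
    then have "L + real j \<le> 2 * c"
      using L that by (simp add: c_def)
    then have "(L + real j) / c\<^sup>2 \<le> 2 * c / c\<^sup>2"
      by (intro divide_right_mono) auto
    then have 2: "(L + real j) / c\<^sup>2 \<le> 2 / c"
      using c by (simp add: power2_eq_square)
    have "L * p j * (2 * y j / c + 1 / c\<^sup>2) - real j * p j * (2 * y j / c - 1 / c\<^sup>2)
        = p j * (2 * (y j * ((L - real j) / c)) + (L + real j) / c\<^sup>2)"
      by (simp add: algebra_simps add_divide_distrib diff_divide_distrib)
    also have "\<dots> \<le> p j * (2 * (- (y j)\<^sup>2) + 2 / c)"
      using 1 2 p(1)[OF that] by (intro mult_left_mono add_mono) auto
    finally show ?thesis
      by (simp add: V algebra_simps)
  qed
  have "(\<Sum>j<C. (L * p j - real (Suc j) * p (Suc j)) * (?V (Suc j) - ?V j))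
      = (\<Sum>j<C. L * p j * (?V (Suc j) - ?V j))
        - (\<Sum>j<C. real (Suc j) * p (Suc j) * (?V (Suc j) - ?V j))"
    by (simp add: left_diff_distrib sum_subtractf)
  also have "\<dots> \<le> (\<Sum>j\<le>C. L * p j * (2 * y j / c + 1 / c\<^sup>2))
        - (\<Sum>j\<le>C. real j * p j * (2 * y j / c - 1 / c\<^sup>2))"
    using birth death by linarith
  also have "\<dots> = (\<Sum>j\<le>C. L * p j * (2 * y j / c + 1 / c\<^sup>2)
        - real j * p j * (2 * y j / c - 1 / c\<^sup>2))"
    by (simp add: sum_subtractf)
  also have "\<dots> \<le> (\<Sum>j\<le>C. - 2 * (?V j * p j) + 2 / c * p j)"
    by (intro sum_mono pointwise) auto
  also have "\<dots> = - 2 * (\<Sum>j\<le>C. ?V j * p j) + 2 / c * (\<Sum>j\<le>C. p j)"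
    by (simp only: sum.distrib sum_distrib_left)
  finally show ?thesis
    by (simp add: p(2) c_def)
qed

section \<open>Tail masses and the bound uniform in time\<close>

lemma tail_mass_nonneg: "(\<And>k. k \<le> C \<Longrightarrow> 0 \<le> p k) \<Longrightarrow> 0 \<le> tail_mass C r p"
  by (auto simp: tail_mass_def intro: sum_nonneg)

lemma sq_excess_moment_le_tail_mass:
  assumes C: "C \<ge> 1" and m: "0 \<le> m" "m \<le> 1" and p: "\<And>k. k \<le> C \<Longrightarrow> 0 \<le> p k"
  shows "(\<Sum>k\<le>C. sq_excess m C k * p k) \<le> tail_mass C (m * real C) p"
proof -
  have "tail_mass C (m * real C) p = (\<Sum>k\<le>C. if m * real C \<le> real k then p k else 0)"
    unfolding tail_mass_def by (subst sum.inter_filter[symmetric]) auto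
  moreover have "sq_excess m C k * p k \<le> (if m * real C \<le> real k then p k else 0)"
    if "k \<le> C" for k
  proof (cases "m * real C \<le> real k")
    case True
    have "real k / real C \<le> 1"
      using that C by simp
    then have "sq_excess m C k \<le> 1"
      unfolding sq_excess_def using m by (intro power_le_one) auto
    then show ?thesis
      using True p[OF that] by (simp add: mult_left_le_one_le sq_excess_def)
  next
    case False
    then have "real k / real C - m \<le> 0"
      using C by (simp add: field_simps)
    then show ?thesis
      using False by (simp add: sq_excess_def)
  qed
  ultimately show ?thesis
    by (auto intro: sum_mono)
qed

text \<open>Chebyshev's inequality. It serves twice: with \<open>r = 1\<close> it controls the mass
  at \<open>C\<close>, hence the birth rate, and with \<open>r < 1\<close> it gives the final tail
  bound.\<close>

lemma tail_mass_le_sq_excess_moment: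
  assumes C: "C \<ge> 1" and "m \<le> r" and p: "\<And>k. k \<le> C \<Longrightarrow> 0 \<le> p k"
  shows "tail_mass C (r * real C) p * (r - m)\<^sup>2 \<le> (\<Sum>k\<le>C. sq_excess m C k * p k)"
proof -
  have "tail_mass C (r * real C) p * (r - m)\<^sup>2
      = (\<Sum>k | k \<le> C \<and> r * real C \<le> real k. (r - m)\<^sup>2 * p k)"
    by (simp add: tail_mass_def sum_distrib_left mult.commute[of _ "(r - m)\<^sup>2"])
  also have "\<dots> \<le> (\<Sum>k | k \<le> C \<and> r * real C \<le> real k. sq_excess m C k * p k)"
  proof (intro sum_mono mult_right_mono)
    fix k assume k: "k \<in> {k. k \<le> C \<and> r * real C \<le> real k}"
    then have "r \<le> real k / real C"
      using C by (simp add: field_simps)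
    then show "(r - m)\<^sup>2 \<le> sq_excess m C k"
      unfolding sq_excess_def using \<open>m \<le> r\<close> by (intro power_mono) auto
    show "0 \<le> p k"
      using k p by auto
  qed
  also have "\<dots> \<le> (\<Sum>k\<le>C. sq_excess m C k * p k)"
    using p by (intro sum_mono2) (auto simp: sq_excess_def)
  finally show ?thesis .
qed

text \<open>The bootstrap: on the level \<open>M\<close> the mass at \<open>C\<close> is at most
  \<delta>, so \<open>rate\<close> applies and the drift bound makes the derivative negative. The
  summand \<open>2 / real C\<close> in \<open>M\<close> makes both the initial inequality and this
  sign strict.\<close>

lemma DAR_sq_excess_moment_bound:
  fixes h :: "real \<Rightarrow> real"
  assumes sol: "DAR_solution h lam C x" and C: "C \<ge> 1" and m: "0 \<le> m" "m < 1"
    and rate: "\<And>u. 0 \<le> u \<Longrightarrow> u \<le> 1 \<Longrightarrow> u \<le> \<delta> \<Longrightarrow> 0 \<le> lam * h u \<and> lam * h u \<le> m * real C"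
    and M: "M = tail_mass C (m * real C) (\<lambda>k. x k 0) + 2 / real C" "M \<le> \<delta> * (1 - m)\<^sup>2"
    and "t \<ge> 0"
  shows "(\<Sum>k\<le>C. sq_excess m C k * x k t) < M"
proof (rule below_barrier[where G = "\<lambda>t. \<Sum>k\<le>C. sq_excess m C k * x k t"])
  note nn = DAR_solution_nonneg[OF sol]
  show "(\<Sum>k\<le>C. sq_excess m C k * x k 0) < M"
    using sq_excess_moment_le_tail_mass[of C m "\<lambda>k. x k 0"] nn[of 0] C m
    by (simp add: M(1) order_le_less_trans[of _ "tail_mass C (m * real C) (\<lambda>k. x k 0)"])
  fix s :: real
  assume s: "s \<ge> 0"
  show "((\<lambda>t. \<Sum>k\<le>C. sq_excess m C k * x k t) has_real_derivative
      (\<Sum>j<C. (lam * h (x C s) * x j s - real (Suc j) * x (Suc j) s)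
        * (sq_excess m C (Suc j) - sq_excess m C j))) (at s within {0..})"
    by (rule DAR_solution_moment_derivative[OF sol C s])
  assume eq: "(\<Sum>k\<le>C. sq_excess m C k * x k s) = M"
  have "{k. k \<le> C \<and> 1 * real C \<le> real k} = {C}"
    by auto
  then have "x C s * (1 - m)\<^sup>2 \<le> M"
    using tail_mass_le_sq_excess_moment[of C m 1 "\<lambda>k. x k s"] nn[of s] s C m eq
    by (simp add: tail_mass_def)
  then have "x C s * (1 - m)\<^sup>2 \<le> \<delta> * (1 - m)\<^sup>2"
    using M(2) by linarith
  then have "x C s \<le> \<delta>"
    using m by simp
  then have L: "0 \<le> lam * h (x C s)" "lam * h (x C s) \<le> m * real C"
    using rate[of "x C s"] nn[OF s, of C] DAR_solution_le_1[OF sol s, of C] by auto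
  have "2 / real C \<le> M"
    using tail_mass_nonneg[of C "\<lambda>k. x k 0"] nn[of 0] by (simp add: M(1))
  moreover have "0 < 2 / real C"
    using C by simp
  ultimately have "- 2 * M + 2 / real C < 0"
    by linarith
  then show "(\<Sum>j<C. (lam * h (x C s) * x j s - real (Suc j) * x (Suc j) s)
        * (sq_excess m C (Suc j) - sq_excess m C j)) < 0"
    using sq_excess_drift[OF C m(1) _ L, of "\<lambda>k. x k s"] nn[OF s] DAR_solution_sum[OF sol s] m eq
    by simp
qed fact

theorem proposition3p3:
  fixes a \<nu> :: real and h :: "real \<Rightarrow> real"
  assumes "a > 1"
    and "\<And>u. h u = 1 + a * u * (1 - u)"
    and "0 < \<nu>" and "\<nu> < 1"
  shows "\<exists>\<eta>. 0 < \<eta> \<and> \<eta> < 1 \<and>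
    (\<forall>x :: nat \<Rightarrow> nat \<Rightarrow> real \<Rightarrow> real.
      (\<forall>C\<ge>1. DAR_solution h (\<nu> * real C) C (x C)) \<longrightarrow>
      (\<lambda>C. tail_mass C (\<eta> * real C) (\<lambda>k. x C k 0)) \<longlonglongrightarrow> 0 \<longrightarrow>
      (\<exists>\<eta>'. 0 < \<eta>' \<and> \<eta>' < 1 \<and>
        (\<lambda>C. SUP t\<in>{0..}. tail_mass C (\<eta>' * real C) (\<lambda>k. x C k t)) \<longlonglongrightarrow> 0))"
proof -
  \<comment> \<open>\<open>m\<close> serves as \<eta> and leaves room on both sides, above \<nu> for
    the rate and below 1 for \<open>r\<close>, which becomes the final threshold. The value of
    \<delta> solves \<open>\<nu> * (1 + a * \<delta>) = m\<close>, where
    \<open>1 + a * \<delta>\<close> bounds \<open>h\<close> on [0, \<delta>] within [0, 1].\<close>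
  define m where "m = (1 + \<nu>) / 2"
  define r where "r = (1 + m) / 2"
  define \<delta> where "\<delta> = (m - \<nu>) / (\<nu> * a)"
  have m: "\<nu> < m" "0 < m" "m < 1" and r: "m < r" "0 < r" "r < 1"
    using assms(3,4) by (auto simp: m_def r_def field_simps)
  have \<delta>: "0 < \<delta>" "\<nu> * (1 + a * \<delta>) = m"
    using m assms by (auto simp: \<delta>_def field_simps)
  have rate: "0 \<le> \<nu> * real C * h u \<and> \<nu> * real C * h u \<le> m * real C"
    if "0 \<le> u" "u \<le> 1" "u \<le> \<delta>" for u C
  proof -
    have "u * (1 - u) \<le> u"
      using that by (simp add: mult_left_le)
    then have "a * (u * (1 - u)) \<le> a * \<delta>"
      using assms(1) that by (intro mult_left_mono) auto
    then have "\<nu> * h u \<le> \<nu> * (1 + a * \<delta>)"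
      unfolding assms(2) using assms(3) by (intro mult_left_mono) (auto simp: mult.assoc)
    then have "real C * (\<nu> * h u) \<le> real C * m"
      unfolding \<delta>(2) by (intro mult_left_mono) auto
    moreover have "0 \<le> h u"
      unfolding assms(2) using that assms(1) by auto
    ultimately show ?thesis
      using assms(3) by (simp add: mult_ac)
  qed
  show ?thesis
  proof (rule exI[of _ m], intro conjI allI impI)
    fix x :: "nat \<Rightarrow> nat \<Rightarrow> real \<Rightarrow> real"
    assume sol: "\<forall>C\<ge>1. DAR_solution h (\<nu> * real C) C (x C)"
      and init: "(\<lambda>C. tail_mass C (m * real C) (\<lambda>k. x C k 0)) \<longlonglongrightarrow> 0"
    define M where "M C = tail_mass C (m * real C) (\<lambda>k. x C k 0) + 2 / real C" for C
    have "(\<lambda>C. 2 / real C) \<longlonglongrightarrow> 0"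
      by (rule lim_const_over_n)
    from tendsto_add[OF init this] have M0: "M \<longlonglongrightarrow> 0"
      by (simp add: M_def[abs_def])
    have "0 < \<delta> * (1 - m)\<^sup>2"
      using \<delta> m by simp
    then have small: "eventually (\<lambda>C. M C < \<delta> * (1 - m)\<^sup>2) sequentially"
      using M0 by (rule order_tendstoD(2)[rotated])
    \<comment> \<open>The upper bound does not depend on \<open>t\<close>, so it passes to the
      supremum.\<close>
    have bound: "0 \<le> tail_mass C (r * real C) (\<lambda>k. x C k t)"
        "tail_mass C (r * real C) (\<lambda>k. x C k t) \<le> M C / (r - m)\<^sup>2"
      if "C \<ge> 1" "M C < \<delta> * (1 - m)\<^sup>2" "t \<ge> 0" for C t
    proof -
      have solC: "DAR_solution h (\<nu> * real C) C (x C)"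
        using sol that by simp
      note nn = DAR_solution_nonneg[OF solC \<open>t \<ge> 0\<close>]
      show "0 \<le> tail_mass C (r * real C) (\<lambda>k. x C k t)"
        by (rule tail_mass_nonneg) (rule nn)
      have "tail_mass C (r * real C) (\<lambda>k. x C k t) * (r - m)\<^sup>2
          \<le> (\<Sum>k\<le>C. sq_excess m C k * x C k t)"
        using tail_mass_le_sq_excess_moment[of C m r "\<lambda>k. x C k t"] nn r \<open>C \<ge> 1\<close> by simp
      also have "\<dots> < M C"
        by (rule DAR_sq_excess_moment_bound[OF solC, where \<delta> = \<delta>])
          (use that m rate in \<open>auto simp: M_def\<close>)
      finally show "tail_mass C (r * real C) (\<lambda>k. x C k t) \<le> M C / (r - m)\<^sup>2"
        using r by (simp add: field_simps)
    qed
    \<comment> \<open>A real \<open>SUP\<close> dominates its members only for a bounded family, so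
      even the lower bound relies on the uniform upper one; the member at time 0 is the
      witness.\<close>
    have "eventually (\<lambda>C. 0 \<le> (SUP t\<in>{0..}. tail_mass C (r * real C) (\<lambda>k. x C k t))) sequentially"
      using small eventually_ge_at_top[of 1]
    proof eventually_elim
      case (elim C)
      then show ?case
        by (intro cSUP_upper2[of _ _ 0] bdd_aboveI2[where M = "M C / (r - m)\<^sup>2"])
          (auto intro: bound)
    qed
    moreover have "eventually (\<lambda>C. (SUP t\<in>{0..}. tail_mass C (r * real C) (\<lambda>k. x C k t))
        \<le> M C / (r - m)\<^sup>2) sequentially"
      using small eventually_ge_at_top[of 1]
      by eventually_elim (auto intro!: cSUP_least bound)
    moreover have "(\<lambda>C. M C / (r - m)\<^sup>2) \<longlonglongrightarrow> 0"
      using tendsto_divide[OF M0 tendsto_const, of "(r - m)\<^sup>2"] r by simp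
    ultimately have "(\<lambda>C. SUP t\<in>{0..}. tail_mass C (r * real C) (\<lambda>k. x C k t)) \<longlonglongrightarrow> 0"
      by (rule tendsto_sandwich[OF _ _ tendsto_const])
    with r show "\<exists>\<eta>'. 0 < \<eta>' \<and> \<eta>' < 1 \<and>
        (\<lambda>C. SUP t\<in>{0..}. tail_mass C (\<eta>' * real C) (\<lambda>k. x C k t)) \<longlonglongrightarrow> 0"
      by (intro exI[of _ r] conjI)
  qed (use m in auto)
qed

end
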